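(* The dimension of the power-$k$ barcode polytope $P_{n,k}$ is $n(2^k+1)-2$.
   Context: Here $k\in\mathbb{Z}_{\ge 0}$ and $n$ is a positive integer (the number of bars). Let $N=n(2^k+1)$. $L((2^k+1)^n)$ is the set of all permutations (words) of the multiset in which each of $1,\ldots,n$ has multiplicity $2^k+1$. $\mathfrak{S}_n$ acts on $L((2^k+1)^n)$ by applying a permutation to every letter; $[s]$ is the orbit of $s$, and $L((2^k+1)^n)/\mathfrak{S}_n$ is the set of orbits. For a word $s$, let $\tau_s\in\mathfrak{S}_n$ be the permutation whose one-line notation is the subword of $s$ formed by the first occurrence of each element, and set $\psi_k([s])=\tau_s^{-1}\circ s$ (independent of the representative $s$). Let $S=\{1_1,1_2,\ldots,1_{2^k+1},2_1,\ldots,n_{2^k+1}\}$, totally ordered lexicographically ($1_1<1_2<\cdots<1_{2^k+1}<2_1<\cdots<n_{2^k+1}$), and identify $S$ with $\{1,\ldots,N\}$ by the order-preserving bijection, so that permutations of $S$ in one-line notation become elements of $\mathfrak{S}_N$. The map $\iota:L((2^k+1)^n)\to\mathfrak{S}_S\cong\mathfrak{S}_N$ replaces, for each $i$, the successive occurrences of $i$ in the word, from left to right, by $i_1,i_2,\ldots,i_{2^k+1}$. The power-$k$ barcode polytope is $P_{n,k}=\mathrm{conv}\{(\pi_1,\ldots,\pi_N)\in\mathbb{R}^N:\pi\in\mathrm{Im}(\iota\circ\psi_k)\}$, where $\iota\circ\psi_k: L((2^k+1)^n)/\mathfrak{S}_n\to\mathfrak{S}_N$.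
   Formalization: The case n = 1 with k ≥ 1 is excluded: there the only word is 1…1, so the polytope is a single point of dimension 0, not 2^k − 1; all other n ≥ 1 and k ≥ 0 are covered. *)

theory Defs
  imports
    "HOL-Analysis.Analysis"
    "HOL-Combinatorics.Multiset_Permutations"
    "HOL-Algebra.Group_Action"
    "HOL-Algebra.Sym_Groups"
begin

definition words :: "nat \<Rightarrow> nat \<Rightarrow> nat list set" where
  "words n k = permutations_of_multiset (\<Sum>i\<in>{1..n}. replicate_mset (2 ^ k + 1) i)"

definition word_orbits :: "nat \<Rightarrow> nat \<Rightarrow> nat list set set" where
  "word_orbits n k = orbits (sym_group n) (words n k) map"

text \<open>One-line notation is 1-based, whereas list access with \<open>!\<close> is 0-based.\<close>

definition one_line :: "nat list \<Rightarrow> nat \<Rightarrow> nat" where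
  "one_line ws i = (if i \<in> {1..length ws} then ws ! (i - 1) else i)"

definition first_occurrences :: "'a list \<Rightarrow> 'a list" where
  "first_occurrences s = nths s {p. s ! p \<notin> set (take p s)}"

definition tau :: "nat list \<Rightarrow> nat \<Rightarrow> nat" where
  "tau s = one_line (first_occurrences s)"

text \<open>The value does not depend on the chosen representative; see \<open>psi_orbit\<close> below.\<close>

definition psi :: "nat list set \<Rightarrow> nat list" where
  "psi c = the_elem ((\<lambda>s. map (inv' (tau s)) s) ` c)"

text \<open>The pair \<open>(i, j)\<close> stands for the letter \<open>i\<^sub>j\<close>. The function \<open>letter_rank k\<close> is the order-preserving
  bijection from the set of these letters onto \<open>{1..n * (2 ^ k + 1)}\<close>; see \<open>letter_rank_bij\<close> and
  \<open>letter_rank_less_iff\<close>.\<close>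

definition letter_rank :: "nat \<Rightarrow> nat \<times> nat \<Rightarrow> nat" where
  "letter_rank k = (\<lambda>(i, j). (i - 1) * (2 ^ k + 1) + j)"

definition label_letters :: "'a list \<Rightarrow> ('a \<times> nat) list" where
  "label_letters s = map (\<lambda>p. (s ! p, count_list (take (Suc p) s) (s ! p))) [0..<length s]"

definition iota :: "nat \<Rightarrow> nat list \<Rightarrow> nat \<Rightarrow> nat" where
  "iota k s = one_line (map (letter_rank k) (label_letters s))"

text \<open>The space \<open>\<real>\<^sup>N\<close> is \<open>real ^ 'm\<close>, where \<open>idx\<close> is meant to be a bijection from \<open>'m\<close> onto
  \<open>{1..N}\<close> that numbers the coordinates.\<close>

definition barcode_polytope :: "('m::finite \<Rightarrow> nat) \<Rightarrow> nat \<Rightarrow> nat \<Rightarrow> (real ^ 'm) set" where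
  "barcode_polytope idx n k =
     convex hull ((\<lambda>\<pi>. \<chi> c. real (\<pi> (idx c))) ` (iota k \<circ> psi) ` word_orbits n k)"

lemma letter_rank_less_iff:
  assumes "i \<in> {1..n}" "i' \<in> {1..n}" "j \<in> {1..2 ^ k + 1}" "j' \<in> {1..2 ^ k + 1}"
  shows "letter_rank k (i, j) < letter_rank k (i', j') \<longleftrightarrow> i < i' \<or> i = i' \<and> j < j'"
proof -
  have *: "letter_rank k (a, b) < letter_rank k (a', b')"
    if "a < a'" "1 \<le> a" "b \<le> 2 ^ k + 1" "1 \<le> b'" for a a' b b'
  proof -
    have "(a - 1) * (2 ^ k + 1) + (2 ^ k + 1) = a * (2 ^ k + 1)"
      using that by (cases a) auto
    also have "\<dots> \<le> (a' - 1) * (2 ^ k + 1)"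
      using that by (intro mult_le_mono) auto
    finally show ?thesis using that unfolding letter_rank_def prod.case by linarith
  qed
  consider "i < i'" | "i = i'" | "i' < i" by linarith
  then show ?thesis
  proof cases
    case 1 then show ?thesis using *[of i i' j j'] assms by simp
  next
    case 2 then show ?thesis by (auto simp: letter_rank_def)
  next
    case 3 then show ?thesis using *[of i' i j' j] assms by simp
  qed
qed

lemma letter_rank_bij: "bij_betw (letter_rank k) ({1..n} \<times> {1..2 ^ k + 1}) {1..n * (2 ^ k + 1)}"
proof -
  let ?S = "{1..n} \<times> {1..2 ^ k + 1} :: (nat \<times> nat) set"
  have inj: "inj_on (letter_rank k) ?S"
  proof (rule inj_onI)
    fix x y assume xy: "x \<in> ?S" "y \<in> ?S" "letter_rank k x = letter_rank k y"
    obtain i j i' j' where "x = (i, j)" "y = (i', j')" by (cases x, cases y)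
    with xy letter_rank_less_iff[of i n i' j k j'] letter_rank_less_iff[of i' n i j' k j]
    show "x = y" by auto
  qed
  have sub: "letter_rank k ` ?S \<subseteq> {1..n * (2 ^ k + 1)}"
  proof clarify
    fix i j :: nat assume ij: "i \<in> {1..n}" "j \<in> {1..2 ^ k + 1}"
    have "letter_rank k (i, j) \<le> (i - 1) * (2 ^ k + 1) + (2 ^ k + 1)"
      unfolding letter_rank_def prod.case using ij by (intro add_left_mono) simp
    also have "\<dots> = i * (2 ^ k + 1)" using ij by (cases i) auto
    also have "\<dots> \<le> n * (2 ^ k + 1)" using ij by (intro mult_le_mono) auto
    finally have "letter_rank k (i, j) \<le> n * (2 ^ k + 1)" .
    moreover have "1 \<le> letter_rank k (i, j)"
      unfolding letter_rank_def prod.case using ij by (intro trans_le_add2) simp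
    ultimately show "letter_rank k (i, j) \<in> {1..n * (2 ^ k + 1)}" by simp
  qed
  have "card (letter_rank k ` ?S) = card {1..n * (2 ^ k + 1)}"
    unfolding card_image[OF inj] card_cartesian_product card_atLeastAtMost by (simp only: diff_Suc_1)
  with sub have "letter_rank k ` ?S = {1..n * (2 ^ k + 1)}"
    by (rule card_subset_eq[OF finite_atLeastAtMost])
  with inj show ?thesis by (rule bij_betw_imageI)
qed

lemma set_words: "s \<in> words n k \<Longrightarrow> set s = {1..n}"
proof -
  assume "s \<in> words n k"
  then have "mset s = (\<Sum>i\<in>{1..n}. replicate_mset (2 ^ k + 1) i)"
    by (simp add: words_def permutations_of_multiset_def)
  then have "set_mset (mset s) = (\<Union>i\<in>{1..n}. set_mset (replicate_mset (2 ^ k + 1) i))"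
    by (simp add: set_mset_sum)
  then show ?thesis by simp
qed

lemma set_first_occurrences: "set (first_occurrences s) = set s"
proof
  show "set (first_occurrences s) \<subseteq> set s"
    unfolding first_occurrences_def by (rule set_nths_subset)
  show "set s \<subseteq> set (first_occurrences s)"
  proof
    fix x assume "x \<in> set s"
    define Q where "Q p \<longleftrightarrow> p < length s \<and> s ! p = x" for p
    define p where "p = (LEAST p. Q p)"
    have "\<exists>p. Q p" using \<open>x \<in> set s\<close> unfolding Q_def in_set_conv_nth .
    then have "Q p" unfolding p_def by (rule LeastI_ex)
    then have p: "p < length s" "s ! p = x" by (simp_all add: Q_def)
    have "\<not> Q q" if "q < p" for q
      using that unfolding p_def by (rule not_less_Least)
    then have "x \<notin> set (take p s)"
      using p(1) by (auto simp: in_set_conv_nth Q_def)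
    with p show "x \<in> set (first_occurrences s)"
      by (auto simp: first_occurrences_def set_nths)
  qed
qed

lemma distinct_first_occurrences: "distinct (first_occurrences s)"
proof (induction s rule: rev_induct)
  case Nil then show ?case by (simp add: first_occurrences_def)
next
  case (snoc x s)
  have "nths s {p. (s @ [x]) ! p \<notin> set (take p (s @ [x]))}
      = nths s {p. s ! p \<notin> set (take p s)}"
    unfolding nths_def
    by (rule arg_cong[where f = "map fst"], rule filter_cong) (auto simp: set_zip nth_append)
  then have "first_occurrences (s @ [x]) =
      first_occurrences s @ (if x \<in> set s then [] else [x])"
    by (simp add: first_occurrences_def nths_append nths_singleton)
  with snoc show ?case by (simp add: set_first_occurrences)
qed

lemma first_occurrences_map:
  assumes "inj f"
  shows "first_occurrences (map f s) = map f (first_occurrences s)"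
proof -
  have "nths (map f s) {p. map f s ! p \<notin> set (take p (map f s))} =
      nths (map f s) {p. s ! p \<notin> set (take p s)}"
    unfolding nths_def
    by (rule arg_cong[where f = "map fst"], rule filter_cong)
      (auto simp: set_zip take_map inj_image_mem_iff[OF assms] inj_eq[OF assms])
  then show ?thesis by (simp add: first_occurrences_def nths_map)
qed

lemma one_line_permutes:
  assumes "distinct ws" "set ws = {1..length ws}"
  shows "one_line ws permutes {1..length ws}"
proof (rule bij_imp_permutes)
  have "bij_betw (\<lambda>i. i - 1) {1..length ws} {..<length ws}"
    by (rule bij_betwI[where g = Suc]) auto
  from bij_betw_trans[OF this bij_betw_nth[OF assms(1) refl assms(2)[symmetric]]]
  show "bij_betw (one_line ws) {1..length ws} {1..length ws}"
    by (rule bij_betw_cong[THEN iffD1, rotated]) (auto simp: one_line_def)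
qed (auto simp: one_line_def)

lemma length_first_occurrences:
  "s \<in> words n k \<Longrightarrow> length (first_occurrences s) = n"
  using distinct_card[OF distinct_first_occurrences[of s]]
  by (simp add: set_first_occurrences set_words)

lemma tau_permutes: "s \<in> words n k \<Longrightarrow> tau s permutes {1..n}"
  using one_line_permutes[OF distinct_first_occurrences, of s]
  by (simp add: tau_def set_first_occurrences set_words length_first_occurrences)

lemma psi_orbit:
  assumes s: "s \<in> words n k"
  shows "psi (orbit (sym_group n) map s) = map (inv' (tau s)) s"
proof -
  have "map (inv' (tau (map \<sigma> s))) (map \<sigma> s) = map (inv' (tau s)) s"
    if \<sigma>: "\<sigma> permutes {1..n}" for \<sigma>
  proof -
    have tau: "tau (map \<sigma> s) = \<sigma> \<circ> tau s"
    proof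
      fix i show "tau (map \<sigma> s) i = (\<sigma> \<circ> tau s) i"
        using s permutes_not_in[OF \<sigma>, of i]
        by (auto simp: tau_def one_line_def first_occurrences_map[OF permutes_inj[OF \<sigma>]]
            length_first_occurrences)
    qed
    have "inv' (\<sigma> \<circ> tau s) = inv' (tau s) \<circ> inv' \<sigma>"
      using permutes_bij[OF \<sigma>] permutes_bij[OF tau_permutes[OF s]] by (rule o_inv_distrib)
    then show ?thesis
      using permutes_inverses(2)[OF \<sigma>] by (simp add: tau)
  qed
  then have const: "map (inv' (tau t)) t = map (inv' (tau s)) s"
    if "t \<in> orbit (sym_group n) map s" for t
    using that by (auto simp: orbit_def sym_group_def)
  have "map id s \<in> orbit (sym_group n) map s"
    unfolding orbit_def sym_group_def using permutes_id[of "{1..n}"] by fastforce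
  then have "orbit (sym_group n) map s \<noteq> {}" by blast
  moreover have "(\<lambda>s. map (inv' (tau s)) s) ` orbit (sym_group n) map s =
      (\<lambda>_. map (inv' (tau s)) s) ` orbit (sym_group n) map s"
    by (rule image_cong[OF refl const])
  ultimately show ?thesis by (simp only: psi_def image_constant_conv if_False the_elem_eq)
qed

text \<open>For a single letter there is only one word, so the dimension is \<open>0\<close>; this equals
  \<open>n * (2 ^ k + 1) - 2 = 2 ^ k - 1\<close> only for \<open>k = 0\<close>.\<close>

lemma aff_dim_barcode_polytope_one: "aff_dim (barcode_polytope idx 1 k) = 0"
proof -
  define w :: "nat list" where "w = replicate (2 ^ k + 1) 1"
  have "mset xs = replicate_mset (2 ^ k + 1) 1 \<longleftrightarrow> xs = w" for xs :: "nat list"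
  proof
    assume eq: "mset xs = replicate_mset (2 ^ k + 1) 1"
    have "length xs = 2 ^ k + 1"
      using arg_cong[OF eq, of size] by (simp only: size_mset size_replicate_mset)
    moreover have "\<forall>y \<in> set xs. y = 1"
      using arg_cong[OF eq, of set_mset] by simp
    ultimately show "xs = w" unfolding w_def by (metis replicate_eqI)
  next
    assume "xs = w"
    then show "mset xs = replicate_mset (2 ^ k + 1) 1"
      by (simp only: w_def mset_replicate)
  qed
  then have "words 1 k = {w}"
    unfolding words_def permutations_of_multiset_def by simp
  then have "word_orbits 1 k = {orbit (sym_group 1) map w}"
    by (simp add: word_orbits_def orbits_def)
  then show ?thesis
    by (simp add: barcode_polytope_def)
qed

end

theory Submission
  imports Defs
begin

text \<open>The first coordinate and the coordinate sum are constant on the points. Conversely, a linear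
  functional \<open>y\<close> that is constant on the points has \<open>y\<^sub>2 = \<dots> = y\<^sub>N\<close>: for each \<open>2 \<le> p < N\<close> some two
  points differ exactly by exchanging the coordinates \<open>p\<close> and \<open>p + 1\<close>, which forces
  \<open>y\<^sub>p = y\<^sub>p\<^sub>+\<^sub>1\<close>. Hence the functionals constant on the points form a space of dimension \<open>2\<close>.\<close>

section \<open>First occurrences in a word\<close>

lemma first_occurrences_Nil [simp]: "first_occurrences [] = []"
  by (simp add: first_occurrences_def)

lemma first_occurrences_snoc:
  "first_occurrences (s @ [x]) = first_occurrences s @ (if x \<in> set s then [] else [x])"
proof -
  have "nths s {p. (s @ [x]) ! p \<notin> set (take p (s @ [x]))} = nths s {p. s ! p \<notin> set (take p s)}"
    unfolding nths_def
    by (rule arg_cong[where f = "map fst"], rule filter_cong) (auto simp: set_zip nth_append)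
  then show ?thesis
    by (simp add: first_occurrences_def nths_append nths_singleton)
qed

text \<open>Once \<open>x\<close> has been read, its later copies contribute nothing and can be
  filtered out. The induction runs from the right because appending a letter does not affect which
  earlier positions are first occurrences.\<close>

lemma first_occurrences_Cons:
  "first_occurrences (x # s) = x # first_occurrences (filter (\<lambda>y. y \<noteq> x) s)"
proof (induction s rule: rev_induct)
  case Nil
  show ?case using first_occurrences_snoc[of "[]" x] by simp
next
  case (snoc y s)
  then show ?case
    using first_occurrences_snoc[of "x # s" y] by (auto simp: first_occurrences_snoc)
qed

text \<open>Filtering out the leading letter deletes exactly the rest of its block, since the other
  blocks consist of different letters.\<close>

lemma first_occurrences_concat_replicate:
  assumes "distinct xs" "m > 0"
  shows "first_occurrences (concat (map (replicate m) xs)) = xs"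
  using assms(1)
proof (induction xs)
  case (Cons x xs)
  obtain j where "m = Suc j"
    using \<open>m > 0\<close> by (cases m) auto
  have "filter (\<lambda>y. y \<noteq> x) (concat (map (replicate m) xs)) = concat (map (replicate m) xs)"
    using Cons.prems by (auto intro: filter_True)
  then have "first_occurrences (concat (map (replicate m) (x # xs)))
      = x # first_occurrences (concat (map (replicate m) xs))"
    using \<open>m = Suc j\<close> by (simp only: list.map concat.simps replicate_Suc append_Cons
        first_occurrences_Cons filter_append) simp
  then show ?case
    using Cons by simp
qed simp

section \<open>Words and their letter counts\<close>

lemma mem_words_iff:
  "s \<in> words n k \<longleftrightarrow> mset s = (\<Sum>i\<in>{1..n}. replicate_mset (2 ^ k + 1) i)"
  by (simp only: words_def permutations_of_multiset_def mem_Collect_eq)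

lemma length_words: "s \<in> words n k \<Longrightarrow> length s = n * (2 ^ k + 1)"
  by (drule mem_words_iff[THEN iffD1], drule arg_cong[where f = size])
    (simp only: size_mset size_multiset_sum size_replicate_mset sum_constant card_atLeastAtMost
      diff_Suc_1 of_nat_id)

lemma count_words:
  assumes "s \<in> words n k" "i \<in> {1..n}"
  shows "count_list s i = 2 ^ k + 1"
proof -
  have "count (mset s) i = (\<Sum>j\<in>{1..n}. if j = i then 2 ^ k + 1 else 0)"
    using mem_words_iff[THEN iffD1, OF assms(1)]
    by (simp only: count_sum count_replicate_mset eq_commute)
  then show ?thesis
    using assms(2) by (simp add: count_mset)
qed

lemma map_permutes_words:
  assumes "s \<in> words n k" "\<sigma> permutes {1..n}"
  shows "map \<sigma> s \<in> words n k"
proof -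
  have im: "image_mset \<sigma> (\<Sum>i\<in>A. replicate_mset m i) = (\<Sum>i\<in>A. replicate_mset m (\<sigma> i))"
    if "finite A" for A :: "nat set" and m
    using that by (induction A rule: finite_induct) simp_all
  have "mset (map \<sigma> s) = (\<Sum>i\<in>{1..n}. replicate_mset (2 ^ k + 1) (\<sigma> i))"
    unfolding mset_map mem_words_iff[THEN iffD1, OF assms(1)] by (rule im) simp
  also have "\<dots> = (\<Sum>i\<in>{1..n}. replicate_mset (2 ^ k + 1) i)"
    by (rule sum.reindex_bij_betw[OF permutes_imp_bij[OF assms(2)]])
  finally show ?thesis by (simp only: mem_words_iff)
qed

section \<open>Occurrence labels and the permutation of a word\<close>

lemma label_letters_snoc:
  "label_letters (s @ [x]) = label_letters s @ [(x, Suc (count_list s x))]"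
  by (auto simp: label_letters_def nth_append)

lemma length_label_letters [simp]: "length (label_letters s) = length s"
  by (simp add: label_letters_def)

lemma label_letters_bounds:
  "(x, j) \<in> set (label_letters s) \<Longrightarrow> x \<in> set s \<and> 1 \<le> j \<and> j \<le> count_list s x"
proof (induction s rule: rev_induct)
  case Nil
  then show ?case by (simp add: label_letters_def)
next
  case (snoc y s)
  then show ?case by (auto simp: label_letters_snoc)
qed

lemma distinct_label_letters: "distinct (label_letters s)"
proof (induction s rule: rev_induct)
  case Nil
  show ?case by (simp add: label_letters_def)
next
  case (snoc x s)
  then show ?case
    using label_letters_bounds[of x "Suc (count_list s x)" s] by (auto simp: label_letters_snoc)
qed

text \<open>A label depends only on the letter and its multiplicity in the prefix. As
  \<open>x\<close> and \<open>y\<close> differ, neither changes the count of the other; beyond the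
  pair both prefixes have the same letter counts, so all later labels agree.\<close>

lemma label_letters_swap:
  assumes "x \<noteq> y"
  shows "\<exists>us u v vs. length us = length xs \<and>
    label_letters (xs @ x # y # ys) = us @ u # v # vs \<and>
    label_letters (xs @ y # x # ys) = us @ v # u # vs"
proof (induction ys rule: rev_induct)
  case Nil
  show ?case
    using assms label_letters_snoc[of "xs @ [x]" y] label_letters_snoc[of "xs @ [y]" x]
    by (intro exI[of _ "label_letters xs"]) (simp add: label_letters_snoc)
next
  case (snoc z ys)
  from snoc.IH obtain us u v vs where IH: "length us = length xs"
    "label_letters (xs @ x # y # ys) = us @ u # v # vs"
    "label_letters (xs @ y # x # ys) = us @ v # u # vs"
    by (elim exE conjE)
  let ?l = "(z, Suc (count_list (xs @ x # y # ys) z))"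
  have "label_letters (xs @ x # y # ys @ [z]) = us @ u # v # vs @ [?l]"
    "label_letters (xs @ y # x # ys @ [z]) = us @ v # u # vs @ [?l]"
    using label_letters_snoc[of "xs @ x # y # ys" z] label_letters_snoc[of "xs @ y # x # ys" z]
    by (simp_all add: IH)
  then show ?case
    using IH(1) by blast
qed

text \<open>Positions in one-line notation are 1-based, so the entry following \<open>us\<close>
  stands at position \<open>Suc (length us)\<close>.\<close>

lemma one_line_swap:
  assumes "p = Suc (length us)"
  shows "one_line (us @ v # u # vs) = one_line (us @ u # v # vs) \<circ> Transposition.transpose p (Suc p)"
proof
  fix i
  show "one_line (us @ v # u # vs) i = (one_line (us @ u # v # vs) \<circ> Transposition.transpose p (Suc p)) i"
    using assms by (auto simp: one_line_def Transposition.transpose_def nth_append nth_Cons split: nat.split)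
qed

lemma iota_swap:
  assumes "x \<noteq> y" "p = Suc (length xs)"
  shows "iota k (xs @ y # x # ys) = iota k (xs @ x # y # ys) \<circ> Transposition.transpose p (Suc p)"
proof -
  obtain us u v vs where "length us = length xs"
    "label_letters (xs @ x # y # ys) = us @ u # v # vs"
    "label_letters (xs @ y # x # ys) = us @ v # u # vs"
    using label_letters_swap[OF assms(1)] by blast
  then show ?thesis
    unfolding iota_def using assms(2) by (simp only: map_append list.map, intro one_line_swap) simp
qed

text \<open>The labels are distinct, lie in the set of all letters i_j, and are as many as that set
  has elements. So each i_j occurs exactly once, and \<open>letter_rank\<close> turns the labelled
  word into an arrangement of 1, ..., N.\<close>

lemma iota_permutes:
  assumes "s \<in> words n k"
  shows "iota k s permutes {1..n * (2 ^ k + 1)}"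
proof -
  let ?L = "label_letters s" and ?S = "{1..n} \<times> {1..2 ^ k + 1} :: (nat \<times> nat) set"
  have len: "length ?L = n * (2 ^ k + 1)"
    using length_words[OF assms] by simp
  have "set ?L \<subseteq> ?S"
  proof (rule subsetI)
    fix z assume z: "z \<in> set ?L"
    obtain x j where xj: "z = (x, j)" by (cases z)
    have "x \<in> {1..n}" "1 \<le> j" "j \<le> count_list s x"
      using label_letters_bounds[of x j s] z xj set_words[OF assms] by simp_all
    then show "z \<in> ?S"
      using count_words[OF assms, of x] unfolding xj mem_Times_iff fst_conv snd_conv atLeastAtMost_iff
      by (simp only: simp_thms)
  qed
  moreover have "card (set ?L) = card ?S"
    unfolding distinct_card[OF distinct_label_letters] len card_cartesian_product card_atLeastAtMost
    by (simp only: diff_Suc_1)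
  ultimately have set: "set ?L = ?S"
    by (intro card_subset_eq finite_cartesian_product finite_atLeastAtMost)
  have "distinct (map (letter_rank k) ?L)"
    unfolding distinct_map set
    using distinct_label_letters bij_betw_imp_inj_on[OF letter_rank_bij[of k n]] by (rule conjI)
  moreover have "set (map (letter_rank k) ?L) = {1..length (map (letter_rank k) ?L)}"
    unfolding set_map set length_map len using letter_rank_bij[of k n] by (simp only: bij_betw_def)
  ultimately have "one_line (map (letter_rank k) ?L) permutes {1..length (map (letter_rank k) ?L)}"
    by (rule one_line_permutes)
  then show ?thesis
    by (simp only: iota_def length_map len)
qed

lemma iota_first: "iota k (1 # s) 1 = 1"
  by (simp add: iota_def one_line_def label_letters_def letter_rank_def upt_conv_Cons del: upt_Suc)

section \<open>Normal forms of orbits\<close>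

text \<open>The permutation \<open>tau s\<close> sends 1 to the first letter of \<open>s\<close>, so
  its inverse renames that letter to 1. Together with \<open>iota_first\<close> this fixes the first
  coordinate of every point.\<close>

lemma psi_orbit_first:
  assumes "s \<in> words n k" "n \<ge> 1"
  obtains t where "psi (orbit (sym_group n) map s) = 1 # t" "1 # t \<in> words n k"
proof -
  have "s \<noteq> []"
    using set_words[OF assms(1)] assms(2) by auto
  then obtain x u where s: "s = x # u" by (cases s) auto
  have "tau s 1 = x"
    by (simp add: tau_def s first_occurrences_Cons one_line_def)
  then have "inv' (tau s) x = 1"
    using permutes_inverses(2)[OF tau_permutes[OF assms(1)], of 1] by simp
  moreover have "map (inv' (tau s)) s \<in> words n k"
    using assms(1) permutes_inv[OF tau_permutes[OF assms(1)]] by (rule map_permutes_words)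
  ultimately show ?thesis
    using that psi_orbit[OF assms(1)] s by simp
qed

text \<open>Such a word is its own normal form, so explicit words of this kind yield points of the
  polytope directly.\<close>

lemma psi_orbit_sorted:
  assumes "s \<in> words n k" "first_occurrences s = [1..<Suc n]"
  shows "psi (orbit (sym_group n) map s) = s"
proof -
  \<comment> \<open>Equality holds on all of nat because \<open>one_line\<close> is the identity
    outside the positions of the list.\<close>
  have "tau s = id"
    by (auto simp: tau_def assms(2) one_line_def nth_append simp del: upt_Suc)
  then show ?thesis
    by (simp add: psi_orbit[OF assms(1)])
qed

section \<open>Points differing by an adjacent transposition\<close>

text \<open>Moving a letter \<open>1\<close> other than the first one past its right neighbour preserves the order of the
  first occurrences; the words \<open>w b\<close> and \<open>w (Suc b)\<close> below are related by such a move.\<close>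

lemma barcode_adjacent_swap:
  assumes "2 \<le> p" "p < n * (2 ^ k + 1)" "n \<ge> 2"
  shows "\<exists>\<pi> \<in> (iota k \<circ> psi) ` word_orbits n k.
    \<pi> \<circ> Transposition.transpose p (Suc p) \<in> (iota k \<circ> psi) ` word_orbits n k"
proof -
  define m :: nat where "m = 2 ^ k + 1"
  define R where "R = concat (map (replicate m) [2..<Suc n])"
  \<comment> \<open>The movable 1 has \<open>a\<close> ones and \<open>b\<close> letters of
    \<open>R\<close> before it, hence stands at position \<open>Suc (a + b) = p\<close>. The cap
    \<open>m - 1\<close> reserves one copy of 1 for the move; the remaining ones go to the end of
    the word.\<close>
  define a where "a = min (p - 1) (m - 1)"
  define b where "b = p - 1 - a"
  define w where "w b = replicate a 1 @ take b R @ 1 # drop b R @ replicate (m - 1 - a) 1" for b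
  have m: "m \<ge> 2" by (simp add: m_def)
  have msR: "mset R = (\<Sum>i\<in>{2..n}. replicate_mset m i)"
  proof -
    have "mset R = (\<Sum>i\<leftarrow>[2..<Suc n]. replicate_mset m i)"
      by (simp only: R_def mset_concat map_map comp_def mset_replicate)
    also have "\<dots> = (\<Sum>i\<in>{2..n}. replicate_mset m i)"
      by (subst sum_list_distinct_conv_sum_set) (simp_all add: atLeastLessThanSuc_atLeastAtMost del: upt_Suc)
    finally show ?thesis .
  qed
  have lenR: "length R = (n - 1) * m"
    using arg_cong[OF msR, of size] by (simp add: size_multiset_sum)
  have lenN: "n * m = length R + m"
    using assms(3) by (cases n) (simp_all add: lenR)
  have R0: "0 < length R"
    using assms(3) m unfolding lenR by simp
  have "p - 1 \<le> length R - 1 + (m - 1)"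
    using assms(2) m R0 lenN unfolding m_def[symmetric] by linarith
  \<comment> \<open>Here \<open>1 \<le> a\<close> keeps a 1 in front and uses
    \<open>2 \<le> p\<close>, while \<open>b < length R\<close> provides a right neighbour
    \<open>R ! b\<close> to exchange with and uses \<open>p < N\<close>.\<close>
  then have ab: "1 \<le> a" "a \<le> m - 1" "b < length R" "p = Suc (a + b)"
    using assms(1) m R0 unfolding a_def b_def by linarith+
  have R1: "1 \<notin> set R" by (auto simp: R_def)
  have w_words: "w c \<in> words n k" for c
  proof -
    have "mset (w c) = replicate_mset a 1 + (mset (take c R) + mset (drop c R))
        + replicate_mset (Suc (m - 1 - a)) 1"
      by (simp add: w_def)
    also have "mset (take c R) + mset (drop c R) = mset R"
      by (simp flip: mset_append)
    also have "replicate_mset a 1 + mset R + replicate_mset (Suc (m - 1 - a)) 1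
        = replicate_mset (a + Suc (m - 1 - a)) 1 + mset R"
      by (rule multiset_eqI) simp
    also have "a + Suc (m - 1 - a) = m"
      using ab m by linarith
    also have "replicate_mset m 1 + mset R = (\<Sum>i\<in>{1..n}. replicate_mset m i)"
      using assms(3) by (subst sum.atLeast_Suc_atMost) (simp_all add: msR numeral_2_eq_2)
    finally show ?thesis
      by (simp only: mem_words_iff m_def)
  qed
  \<comment> \<open>Since the word starts with 1, the position of the movable 1 is irrelevant:
    filtering out the ones always leaves \<open>R\<close>.\<close>
  have w_fo: "first_occurrences (w c) = [1..<Suc n]" for c
  proof -
    obtain j where j: "a = Suc j" using ab(1) by (cases a) auto
    have "filter (\<lambda>y. y \<noteq> 1) xs = xs" if "set xs \<subseteq> set R" for xs
      using that R1 by (auto intro!: filter_True)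
    from this[OF set_take_subset] this[OF set_drop_subset]
    have "first_occurrences (w c) = 1 # first_occurrences R"
      by (simp add: w_def j first_occurrences_Cons)
    also have "first_occurrences R = [2..<Suc n]"
      unfolding R_def using m by (intro first_occurrences_concat_replicate) auto
    finally show ?thesis
      using assms(3) by (simp add: upt_conv_Cons[of "Suc 0"] numeral_2_eq_2 del: upt_Suc)
  qed
  have mem: "iota k (w c) \<in> (iota k \<circ> psi) ` word_orbits n k" for c
  proof
    show "iota k (w c) = (iota k \<circ> psi) (orbit (sym_group n) map (w c))"
      by (simp add: psi_orbit_sorted[OF w_words w_fo])
    show "orbit (sym_group n) map (w c) \<in> word_orbits n k"
      using w_words by (auto simp: word_orbits_def orbits_def)
  qed
  let ?xs = "replicate a 1 @ take b R" and ?ys = "drop (Suc b) R @ replicate (m - 1 - a) 1"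
  have "w b = ?xs @ 1 # R ! b # ?ys" "w (Suc b) = ?xs @ R ! b # 1 # ?ys"
    using ab(3) by (simp_all add: w_def Cons_nth_drop_Suc[symmetric] take_Suc_conv_app_nth)
  moreover have "1 \<noteq> R ! b"
    using R1 nth_mem[OF ab(3)] by auto
  moreover have "p = Suc (length ?xs)"
    using ab by simp
  ultimately have "iota k (w (Suc b)) = iota k (w b) \<circ> Transposition.transpose p (Suc p)"
    using iota_swap[of 1 "R ! b" p ?xs k ?ys] by (simp only: simp_thms)
  then show ?thesis
    using mem[of b] mem[of "Suc b"] by (intro bexI[of _ "iota k (w b)"]) simp_all
qed

section \<open>Dimensions of spans and orthogonal complements\<close>

text \<open>Were the unit vector a multiple of the all-ones vector \<open>1\<close>, coordinate
  \<open>c\<close> would give the factor 1 and coordinate \<open>d\<close> the factor 0.\<close>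

lemma dim_axis_one:
  fixes c d :: "'m::finite"
  assumes "c \<noteq> d"
  shows "dim {axis c 1, 1 :: real ^ 'm} = 2"
proof -
  have "axis c 1 \<notin> span {1 :: real ^ 'm}"
  proof
    assume "axis c 1 \<in> span {1 :: real ^ 'm}"
    then obtain r where r: "axis c 1 = r *\<^sub>R (1 :: real ^ 'm)"
      by (auto simp: span_singleton)
    show False
      using arg_cong[OF r, of "\<lambda>x. x $ c"] arg_cong[OF r, of "\<lambda>x. x $ d"] assms
      by (simp add: axis_def)
  qed
  moreover have "(1 :: real ^ 'm) \<noteq> 0"
    by (simp add: vec_eq_iff)
  ultimately have "independent {axis c 1, 1 :: real ^ 'm}" "axis c 1 \<noteq> (1 :: real ^ 'm)"
    using span_base[of "1 :: real ^ 'm" "{1}"] by (auto simp: independent_insert)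
  then show ?thesis
    by (simp add: dim_eq_card_independent)
qed

text \<open>Orthogonality to \<open>S\<close> extends to its span, which reduces the claim to the
  known formula for subspaces.\<close>

lemma dim_orthogonal_complement:
  fixes S :: "'a::euclidean_space set"
  shows "dim {y. \<forall>x\<in>S. orthogonal x y} + dim S = DIM('a)"
proof -
  have "{y. \<forall>x\<in>S. orthogonal x y} = {y \<in> UNIV. \<forall>x\<in>span S. orthogonal x y}"
    by (auto simp: span_base) (metis orthogonal_commute orthogonal_to_span)
  then show ?thesis
    using dim_subspace_orthogonal_to_vectors[of "span S" UNIV] by simp
qed

section \<open>The dimension of the polytope\<close>

theorem corollary2:
  fixes n k :: nat and idx :: "'m::finite \<Rightarrow> nat"
  assumes "n \<ge> 1"
    and "n = 1 \<longrightarrow> k = 0"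
    and "bij_betw idx UNIV {1..n * (2 ^ k + 1)}"
  shows "aff_dim (barcode_polytope idx n k) = int (n * (2 ^ k + 1)) - 2"
proof -
  define N where "N = n * (2 ^ k + 1)"
  define P where "P = (iota k \<circ> psi) ` word_orbits n k"
  define pt where "pt \<pi> = (\<chi> c. real (\<pi> (idx c)) :: real ^ 'm)" for \<pi> :: "nat \<Rightarrow> nat"
  have idx: "bij_betw idx UNIV {1..N}"
    using assms(3) by (simp only: N_def)
  have card: "CARD('m) = N"
    using bij_betw_same_card[OF idx] by simp
  have N2: "N \<ge> 2"
    using mult_le_mono[OF assms(1), of 2 "2 ^ k + 1"] by (simp add: N_def)
  define e where "e = inv' idx"
  have e: "idx (e i) = i" if "i \<in> {1..N}" for i
    using that idx unfolding e_def bij_betw_def by (intro f_inv_into_f) auto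
  have e': "e (idx c) = c" for c
    using idx unfolding e_def bij_betw_def by simp
  have idx_range: "idx c \<in> {1..N}" for c
    using idx unfolding bij_betw_def by auto
  have perm: "\<pi> permutes {1..N}" and first: "\<pi> 1 = 1" if "\<pi> \<in> P" for \<pi>
  proof -
    obtain s where s: "s \<in> words n k" "\<pi> = iota k (psi (orbit (sym_group n) map s))"
      using \<open>\<pi> \<in> P\<close> by (auto simp: P_def word_orbits_def orbits_def)
    obtain t where "psi (orbit (sym_group n) map s) = 1 # t" "1 # t \<in> words n k"
      using psi_orbit_first[OF s(1) assms(1)] .
    with s(2) show "\<pi> permutes {1..N}" "\<pi> 1 = 1"
      by (simp_all only: iota_permutes iota_first N_def)
  qed
  have inner1: "pt \<pi> \<bullet> 1 = (\<Sum>i\<in>{1..N}. real i)" if "\<pi> \<in> P" for \<pi>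
  proof -
    have "pt \<pi> \<bullet> 1 = (\<Sum>c\<in>UNIV. real (\<pi> (idx c)))"
      by (simp add: inner_vec_def pt_def)
    also have "\<dots> = (\<Sum>i\<in>{1..N}. real (\<pi> i))"
      by (rule sum.reindex_bij_betw[OF idx])
    also have "\<dots> = (\<Sum>i\<in>{1..N}. real i)"
      by (rule sum.reindex_bij_betw[OF permutes_imp_bij[OF perm[OF that]]])
    finally show ?thesis .
  qed
  have inner_first: "pt \<pi> \<bullet> axis (e 1) 1 = 1" if "\<pi> \<in> P" for \<pi>
    using N2 by (simp add: inner_axis pt_def e first[OF that, simplified])
  have "P \<noteq> {}"
  proof -
    have "words n k \<noteq> {}"
      by (simp add: words_def)
    then show ?thesis
      by (auto simp: P_def word_orbits_def orbits_def)
  qed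
  then obtain \<pi>0 where \<pi>0: "\<pi>0 \<in> P" by blast
  \<comment> \<open>Translating a point of the set to the origin makes the affine dimension the
    linear dimension of \<open>D\<close>; the vectors orthogonal to \<open>D\<close> are the
    functionals constant on the points.\<close>
  define D where "D = (\<lambda>x. - pt \<pi>0 + x) ` pt ` P"
  have "{y. \<forall>x\<in>D. orthogonal x y} = span {axis (e 1) 1, 1}"
  proof
    show "span {axis (e 1) 1, 1} \<subseteq> {y. \<forall>x\<in>D. orthogonal x y}"
    proof clarify
      fix x y assume "y \<in> span {axis (e 1) 1, 1 :: real ^ 'm}" "x \<in> D"
      then show "orthogonal x y"
        by (elim orthogonal_to_span)
          (auto simp: D_def orthogonal_def inner_diff_left inner1 inner_first[simplified] \<pi>0)
    qed
    show "{y. \<forall>x\<in>D. orthogonal x y} \<subseteq> span {axis (e 1) 1, 1}"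
    proof clarify
      fix y assume "\<forall>x\<in>D. orthogonal x y"
      then have const: "pt \<pi> \<bullet> y = pt \<pi>0 \<bullet> y" if "\<pi> \<in> P" for \<pi>
        using that by (simp add: D_def orthogonal_def inner_diff_left)
      have pt_sum: "pt \<pi> \<bullet> y = (\<Sum>i\<in>{1..N}. real (\<pi> i) * y $ e i)" for \<pi>
      proof -
        have "pt \<pi> \<bullet> y = (\<Sum>c\<in>UNIV. real (\<pi> (idx c)) * y $ e (idx c))"
          by (simp add: inner_vec_def pt_def e')
        also have "\<dots> = (\<Sum>i\<in>{1..N}. real (\<pi> i) * y $ e i)"
          by (rule sum.reindex_bij_betw[OF idx])
        finally show ?thesis .
      qed
      \<comment> \<open>For \<open>n = 1\<close> the hypothesis gives \<open>k = 0\<close> and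
        \<open>N = 2\<close>, so no \<open>p\<close> with \<open>2 \<le> p < N\<close> exists and no
        exchange is required.\<close>
      have n2: "n \<ge> 2" if "2 < N"
        using that assms(1,2) by (cases "n = 1") (auto simp: N_def)
      have step: "y $ e (Suc p) = y $ e p" if p: "2 \<le> p" "p < N" for p
      proof -
        obtain \<pi> where \<pi>: "\<pi> \<in> P" "\<pi> \<circ> Transposition.transpose p (Suc p) \<in> P"
          using barcode_adjacent_swap[OF p(1) p(2)[unfolded N_def] n2] p unfolding P_def by auto
        let ?q = "Suc p"
        have split: "(\<Sum>i\<in>{1..N}. f i) = f p + f ?q + (\<Sum>i\<in>{1..N} - {p, ?q}. f i)"
          for f :: "nat \<Rightarrow> real"
          using p sum.subset_diff[of "{p, ?q}" "{1..N}" f] by simp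
        have "(\<Sum>i\<in>{1..N}. real (\<pi> i) * y $ e i)
            = (\<Sum>i\<in>{1..N}. real ((\<pi> \<circ> Transposition.transpose p ?q) i) * y $ e i)"
          using const[OF \<pi>(1)] const[OF \<pi>(2)] by (simp only: pt_sum)
        moreover have "(\<Sum>i\<in>{1..N} - {p, ?q}. real ((\<pi> \<circ> Transposition.transpose p ?q) i) * y $ e i)
            = (\<Sum>i\<in>{1..N} - {p, ?q}. real (\<pi> i) * y $ e i)"
          by (rule sum.cong) (auto simp: Transposition.transpose_def)
        ultimately have "real (\<pi> p) * y $ e p + real (\<pi> ?q) * y $ e ?q
            = real (\<pi> ?q) * y $ e p + real (\<pi> p) * y $ e ?q"
          unfolding split by simp
        \<comment> \<open>All terms outside the two exchanged positions cancel. The remaining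
          difference factors, and the first factor is nonzero because \<open>\<pi>\<close> is
          injective.\<close>
        then have "(real (\<pi> p) - real (\<pi> ?q)) * (y $ e ?q - y $ e p) = 0"
          by algebra
        moreover have "\<pi> p \<noteq> \<pi> ?q"
          using permutes_inj[OF perm[OF \<pi>(1)]] by (metis injD n_not_Suc_n)
        ultimately show ?thesis by simp
      qed
      have const_tail: "y $ e i = y $ e 2" if "2 \<le> i" "i \<le> N" for i
        using that by (induction i rule: dec_induct) (auto simp: step)
      \<comment> \<open>The common value on the coordinates numbered 2 to \<open>N\<close> is the
        coefficient of \<open>1\<close>; the unit vector corrects the coordinate numbered 1.\<close>
      have "y $ c = ((y $ e 1 - y $ e 2) *\<^sub>R axis (e 1) 1 + (y $ e 2) *\<^sub>R 1) $ c" for c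
      proof (cases "idx c = 1")
        case True
        then have "c = e 1" using e'[of c] by simp
        then show ?thesis by simp
      next
        case False
        then have "c \<noteq> e 1" using e[of 1] N2 by auto
        moreover have "y $ c = y $ e 2"
          using const_tail[of "idx c"] idx_range[of c] False e'[of c] by simp
        ultimately show ?thesis by (simp add: axis_def)
      qed
      then have "y = (y $ e 1 - y $ e 2) *\<^sub>R axis (e 1) 1 + (y $ e 2) *\<^sub>R 1"
        unfolding vec_eq_iff by blast
      moreover have "r *\<^sub>R axis (e 1) 1 + q *\<^sub>R 1 \<in> span {axis (e 1) 1, 1 :: real ^ 'm}" for r q
        by (intro span_add span_scale span_base) auto
      ultimately show "y \<in> span {axis (e 1) 1, 1}"
        by metis
    qed
  qed
  moreover have "e 1 \<noteq> e 2"
    using e[of 1] e[of 2] N2 by auto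
  ultimately have dimD: "dim D + 2 = N"
    using dim_orthogonal_complement[of D] card by (simp add: dim_axis_one)
  have "barcode_polytope idx n k = convex hull (pt ` P)"
    by (simp add: barcode_polytope_def P_def pt_def[abs_def])
  then have "aff_dim (barcode_polytope idx n k) = aff_dim (pt ` P)"
    by (simp only: aff_dim_convex_hull)
  also have "\<dots> = int (dim D)"
    unfolding D_def using \<pi>0 by (intro aff_dim_eq_dim hull_inc) auto
  also have "\<dots> = int N - 2"
    using dimD by linarith
  finally show ?thesis
    by (simp only: N_def)
qed

end
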